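(* Let $(X_j)_{j\ge1}$ be independent Bernoulli trials with success probabilities $p_j=1-q_j=\mathbb{P}(X_j=1)>0$, and let $M$ be the Markov chain embedded in the success epochs of the trials, with state space $S=\{0\}\cup\mathbb{N}\cup\{\infty\}$ and one-step transition matrix $P=(P(i,j))_{i,j\in S}$. Then $M$ is totally positive, i.e. all minors of all orders of $P$ are nonnegative.
   Context: $S=\{0,1,2,\dots,\infty\}$ with its natural order ($\infty$ largest). The chain $M$ starts by default in $0$, visits in order the indices of the successes, and is absorbed at $\infty$ after the last success, if there are finitely many. Its transition matrix is $P(i,j)=0$ for $j\le i$, $j<\infty$; $P(i,j)=p_j\prod_{k=i+1}^{j-1}q_k$ for $i<j<\infty$; $P(i,\infty)=\prod_{k\ge i+1}q_k$ for $i<\infty$; and $P(\infty,\infty)=1$. Empty products equal $1$. A Markov chain is called totally positive if its transition matrix is; a minor is the determinant of a finite square submatrix with rows and columns taken in increasing order. *)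

theory Defs
  imports
    "HOL-Probability.Probability"
    "Jordan_Normal_Form.Determinant"
begin

definition minor :: "('s \<Rightarrow> 's \<Rightarrow> real) \<Rightarrow> nat \<Rightarrow> (nat \<Rightarrow> 's) \<Rightarrow> (nat \<Rightarrow> 's) \<Rightarrow> real" where
  "minor P n r c = Determinant.det (Matrix.mat n n (\<lambda>(a, b). P (r a) (c b)))"

definition totally_positive :: "('s::linorder \<Rightarrow> 's \<Rightarrow> real) \<Rightarrow> bool" where
  "totally_positive P \<longleftrightarrow>
     (\<forall>n r c. strict_mono_on {..<n} r \<longrightarrow> strict_mono_on {..<n} c \<longrightarrow> 0 \<le> minor P n r c)"

text \<open>A time-homogeneous Markov chain on a countable state space. The initial distribution is left
  open; rows of \<open>P\<close> at states that are never visited are only required to be probability vectors.\<close>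

definition markov_chain :: "'a measure \<Rightarrow> (nat \<Rightarrow> 'a \<Rightarrow> 's::countable) \<Rightarrow> ('s \<Rightarrow> 's \<Rightarrow> real) \<Rightarrow> bool" where
  "markov_chain \<Omega> Y P \<longleftrightarrow>
     prob_space \<Omega> \<and>
     (\<forall>n. Y n \<in> measurable \<Omega> (count_space UNIV)) \<and>
     (\<forall>i j. 0 \<le> P i j) \<and> (\<forall>i. (P i has_sum 1) UNIV) \<and>
     (\<forall>n s j. measure \<Omega> {\<omega> \<in> space \<Omega>. \<forall>k\<le>n. Y k \<omega> = s k} > 0 \<longrightarrow>
        cond_prob \<Omega> (\<lambda>\<omega>. Y (Suc n) \<omega> = j) (\<lambda>\<omega>. \<forall>k\<le>n. Y k \<omega> = s k) = P (s n) j)"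

text \<open>Trials are indexed from 1 on: \<open>X 0\<close> is never inspected. If there is no later success, the
  infimum is that of the empty set, which is \<open>\<infinity>\<close>.\<close>

primrec success_chain :: "(nat \<Rightarrow> 'a \<Rightarrow> bool) \<Rightarrow> nat \<Rightarrow> 'a \<Rightarrow> enat" where
  "success_chain X 0 \<omega> = 0"
| "success_chain X (Suc n) \<omega> = Inf {enat j | j. success_chain X n \<omega> < enat j \<and> X j \<omega>}"

text \<open>The infinite product is written as the limit of its partial products, because \<^const>\<open>prodinf\<close>
  is unspecified for products that diverge to 0.\<close>

fun success_matrix :: "(nat \<Rightarrow> real) \<Rightarrow> enat \<Rightarrow> enat \<Rightarrow> real" where
  "success_matrix p (enat i) (enat j) = (if i < j then p j * (\<Prod>k=i+1..<j. 1 - p k) else 0)"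
| "success_matrix p (enat i) \<infinity> = lim (\<lambda>n. \<Prod>k=i+1..n. 1 - p k)"
| "success_matrix p \<infinity> (enat j) = 0"
| "success_matrix p \<infinity> \<infinity> = 1"

end

theory Submission
  imports Defs
begin

text \<open>Expand a minor along its first column \<open>c\<^sub>0\<close>. If \<open>c\<^sub>0 \<le> r\<^sub>1\<close>, at most the top entry of that column
  is nonzero and induction applies. If \<open>r\<^sub>1 < c\<^sub>0\<close>, the first two rows are proportional, because a
  chain started in \<open>r\<^sub>0\<close> that jumps beyond \<open>r\<^sub>1\<close> sees only failures up to \<open>r\<^sub>1\<close> and then
  continues as if started in \<open>r\<^sub>1\<close>.

  For the Markov property, a path of the chain ending in a finite state \<open>i\<close> determines the
  outcomes of the trials \<open>1, \<dots>, i\<close> and is determined by them, so all events in question are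
  cylinder sets, or decreasing limits of such for jumps to \<open>\<infinity>\<close>.\<close>

section \<open>Determinant identities and a criterion for total positivity\<close>

text \<open>Adding \<open>- a\<close> times row 1 to row 0 preserves the determinant and makes row 0
  vanish, so the Laplace expansion along row 0 is zero. The size \<open>Suc (Suc n)\<close> ensures
  that both rows exist.\<close>

lemma det_first_two_rows_proportional:
  fixes f :: "nat \<Rightarrow> nat \<Rightarrow> real"
  assumes "\<And>b. b < Suc (Suc n) \<Longrightarrow> f 0 b = a * f 1 b"
  shows "Determinant.det (Matrix.mat (Suc (Suc n)) (Suc (Suc n)) (\<lambda>(i, j). f i j)) = 0"
proof -
  let ?N = "Suc (Suc n)"
  let ?A = "Matrix.mat ?N ?N (\<lambda>(i, j). f i j)"
  have A: "?A \<in> carrier_mat ?N ?N" by simp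
  have "Determinant.det (addrow (- a) 0 1 ?A) = Determinant.det ?A"
    by (rule det_addrow[OF _ _ A]) auto
  moreover have "Determinant.det (addrow (- a) 0 1 ?A) = 0"
  proof -
    have "addrow (- a) 0 1 ?A $$ (0, b) = 0" if "b < ?N" for b
      using that assms[OF that] by (simp add: mat_addrow_def)
    then have "(\<Sum>b<?N. addrow (- a) 0 1 ?A $$ (0, b) * cofactor (addrow (- a) 0 1 ?A) 0 b) = 0"
      by (intro sum.neutral) auto
    then show ?thesis
      using laplace_expansion_row[of "addrow (- a) 0 1 ?A" ?N 0] A by simp
  qed
  ultimately show ?thesis by simp
qed

text \<open>Laplace expansion along column 0 keeps only its top term. Deleting the first row and
  column shifts both index maps by \<open>Suc\<close>, so the cofactor is again a minor of
  \<open>P\<close> and an induction on the order can use it.\<close>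

lemma minor_first_column:
  assumes "\<And>a. 0 < a \<Longrightarrow> a < Suc n \<Longrightarrow> P (r a) (c 0) = 0"
  shows "minor P (Suc n) r c = P (r 0) (c 0) * minor P n (r \<circ> Suc) (c \<circ> Suc)"
proof -
  let ?A = "Matrix.mat (Suc n) (Suc n) (\<lambda>(a, b). P (r a) (c b))"
  have "mat_delete ?A 0 0 = Matrix.mat n n (\<lambda>(a, b). P ((r \<circ> Suc) a) ((c \<circ> Suc) b))"
    by (rule eq_matI) (auto simp: mat_delete_def)
  then have "cofactor ?A 0 0 = minor P n (r \<circ> Suc) (c \<circ> Suc)"
    by (simp add: cofactor_def minor_def)
  moreover have "Determinant.det ?A = (\<Sum>a<Suc n. ?A $$ (a, 0) * cofactor ?A a 0)"
    by (rule laplace_expansion_column) auto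
  moreover have "\<dots> = ?A $$ (0, 0) * cofactor ?A 0 0"
    by (subst sum.remove[of _ 0]) (auto intro!: sum.neutral simp: assms)
  ultimately show ?thesis by (simp add: minor_def)
qed

text \<open>The condition \<open>j < j'\<close> in the second hypothesis exempts the last column: the matrix need not be
  triangular at an absorbing top state.\<close>

lemma totally_positive_if_rows_proportional:
  fixes P :: "'s::linorder \<Rightarrow> 's \<Rightarrow> real"
  assumes nonneg: "\<And>i j. 0 \<le> P i j"
    and tri: "\<And>i j j'. j < j' \<Longrightarrow> j \<le> i \<Longrightarrow> P i j = 0"
    and rows: "\<And>i i'. i < i' \<Longrightarrow> \<exists>a. \<forall>j>i'. P i j = a * P i' j"
  shows "totally_positive P"
proof -
  have "0 \<le> minor P n r c"
    if "strict_mono_on {..<n} r" "strict_mono_on {..<n} c" for n r c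
    using that
  proof (induction n arbitrary: r c)
    case 0
    then show ?case by (simp add: minor_def)
  next
    case (Suc n)
    have IH: "0 \<le> minor P n (r \<circ> Suc) (c \<circ> Suc)"
      using Suc.prems by (intro Suc.IH) (auto simp: strict_mono_on_def)
    show ?case
    \<comment> \<open>Order one is separate: it is a single entry of \<open>P\<close>, and there is
      no second column \<open>c 1\<close> to serve as the witness \<open>j'\<close> in
      \<open>tri\<close>.\<close>
    proof (cases n)
      case 0
      then show ?thesis
        using IH nonneg by (subst minor_first_column) auto
    next
      case (Suc m)
      have c01: "c 0 < c 1"
        using Suc.prems(2) Suc by (auto simp: strict_mono_on_def)
      have r01: "r 0 < r 1"
        using Suc.prems(1) Suc by (auto simp: strict_mono_on_def)
      show ?thesis
      proof (cases "c 0 \<le> r 1")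
        case True
        have "P (r a) (c 0) = 0" if "0 < a" "a < Suc n" for a
        proof -
          have "r 1 \<le> r a"
            using that Suc.prems(1) by (cases "a = 1") (auto simp: strict_mono_on_def intro!: less_imp_le)
          then show ?thesis using tri[OF c01] True by auto
        qed
        then show ?thesis
          using IH nonneg by (subst minor_first_column) auto
      next
        case False
        obtain a where a: "\<And>j. r 1 < j \<Longrightarrow> P (r 0) j = a * P (r 1) j"
          using rows[OF r01] by blast
        \<comment> \<open>Since \<open>c\<close> increases, all selected columns lie beyond
          \<open>r 1\<close>; the proportionality therefore covers the two top rows of the minor
          entirely.\<close>
        have "r 1 < c b" if "b < Suc (Suc m)" for b
        proof -
          have "c 0 \<le> c b"
            using that Suc Suc.prems(2) by (cases "b = 0") (auto simp: strict_mono_on_def intro!: less_imp_le)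
          then show ?thesis using False by auto
        qed
        then have "minor P (Suc (Suc m)) r c = 0"
          unfolding minor_def by (intro det_first_two_rows_proportional[where a = a]) (use a in simp)
        then show ?thesis using Suc by simp
      qed
    qed
  qed
  then show ?thesis by (simp add: totally_positive_def)
qed

section \<open>The success matrix: row sums and total positivity\<close>

context
  fixes p :: "nat \<Rightarrow> real"
  assumes p_nonneg: "\<And>j. 1 \<le> j \<Longrightarrow> 0 \<le> p j" and p_le_1: "\<And>j. 1 \<le> j \<Longrightarrow> p j \<le> 1"
begin

text \<open>The partial products are nonnegative and, each factor being in [0, 1], decreasing. Hence
  they converge, and the \<open>lim\<close> in the matrix entry really is their limit.\<close>

lemma failure_prod_tendsto:
  "(\<lambda>n. \<Prod>k=i+1..n. 1 - p k) \<longlonglongrightarrow> success_matrix p (enat i) \<infinity>"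
proof -
  have pos: "0 \<le> (\<Prod>k=i+1..n. 1 - p k)" for n
    using p_le_1 by (intro prod_nonneg) auto
  have "(\<Prod>k=i+1..Suc n. 1 - p k) \<le> (\<Prod>k=i+1..n. 1 - p k)" for n
  proof (cases "i + 1 \<le> Suc n")
    case True
    have "(\<Prod>k=i+1..n. 1 - p k) * (1 - p (Suc n)) \<le> (\<Prod>k=i+1..n. 1 - p k)"
      using pos[of n] p_nonneg[of "Suc n"] p_le_1[of "Suc n"] by (intro mult_left_le) auto
    then show ?thesis using True by (simp add: prod.nat_ivl_Suc' mult.commute)
  qed auto
  then have "decseq (\<lambda>n. \<Prod>k=i+1..n. 1 - p k)"
    by (rule decseq_SucI)
  then obtain L where "(\<lambda>n. \<Prod>k=i+1..n. 1 - p k) \<longlonglongrightarrow> L"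
    using decseq_convergent pos by metis
  then show ?thesis by (simp add: limI)
qed

lemma success_matrix_nonneg: "0 \<le> success_matrix p i j"
proof (cases i; cases j)
  fix i' j' assume "i = enat i'" "j = enat j'"
  then show ?thesis
    using p_nonneg[of j'] p_le_1 by (auto intro!: mult_nonneg_nonneg prod_nonneg)
next
  fix i' assume "i = enat i'" "j = \<infinity>"
  moreover have "0 \<le> success_matrix p (enat i') \<infinity>"
    using p_le_1 by (intro LIMSEQ_le_const[OF failure_prod_tendsto]) (auto intro!: prod_nonneg)
  ultimately show ?thesis by simp
qed auto

lemma success_matrix_has_sum: "(success_matrix p i has_sum 1) UNIV"
proof (cases i)
  case (enat i')
  \<comment> \<open>The sum telescopes: from \<open>n\<close> to \<open>Suc n\<close> the failure
    product drops by exactly \<open>p n\<close> times itself if \<open>i' < n\<close>. For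
    \<open>n \<le> i'\<close> the new entry is 0 and both products are empty.\<close>
  have part: "(\<Sum>j<n. success_matrix p (enat i') (enat j)) = 1 - (\<Prod>k=i'+1..<n. 1 - p k)" for n
  proof (induction n)
    case (Suc n)
    show ?case
    proof (cases "i' < n")
      case True
      then show ?thesis using Suc by (simp add: algebra_simps)
    next
      case False
      then show ?thesis using Suc by simp
    qed
  qed simp
  have "(\<lambda>n. \<Prod>k=i'+1..<Suc n. 1 - p k) \<longlonglongrightarrow> success_matrix p (enat i') \<infinity>"
    using failure_prod_tendsto[of i'] by (simp add: atLeastLessThanSuc_atLeastAtMost)
  then have "(\<lambda>n. \<Prod>k=i'+1..<n. 1 - p k) \<longlonglongrightarrow> success_matrix p (enat i') \<infinity>"
    by (rule LIMSEQ_imp_Suc)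
  \<comment> \<open>The finite states carry all mass except the limit of the failure products; the
    entry at \<infinity>, inserted below, supplies what is missing.\<close>
  then have "(\<lambda>j. success_matrix p (enat i') (enat j)) sums (1 - success_matrix p (enat i') \<infinity>)"
    unfolding sums_def part by (intro tendsto_intros)
  then have "((\<lambda>j. success_matrix p (enat i') (enat j)) has_sum (1 - success_matrix p (enat i') \<infinity>)) UNIV"
    by (intro sums_nonneg_imp_has_sum success_matrix_nonneg)
  then have "(success_matrix p (enat i') has_sum (1 - success_matrix p (enat i') \<infinity>)) (range enat)"
    by (subst has_sum_reindex) (simp_all add: inj_on_def o_def del: success_matrix.simps)
  then have "(success_matrix p (enat i') has_sum
      (success_matrix p (enat i') \<infinity> + (1 - success_matrix p (enat i') \<infinity>))) (insert \<infinity> (range enat))"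
    by (intro has_sum_insert) auto
  moreover have "insert \<infinity> (range enat) = UNIV"
    by (metis UNIV_eq_I insertCI not_infinity_eq rangeI)
  ultimately show ?thesis using enat by simp
next
  case infinity
  have "(success_matrix p \<infinity> has_sum 1) {\<infinity>}"
    by (rule has_sum_finiteI) auto
  moreover have "success_matrix p \<infinity> j = 0" if "j \<noteq> \<infinity>" for j
    using that by (cases j) auto
  ultimately show ?thesis
    unfolding infinity by (subst has_sum_cong_neutral[of "{\<infinity>}" UNIV]) auto
qed

text \<open>The failure product from \<open>i + 1\<close> on splits at \<open>i'\<close>, and its
  first block does not depend on \<open>j\<close>. For \<open>j = \<infinity>\<close> the split
  holds once \<open>n \<ge> i'\<close>, and the factor passes through the limit.\<close>

lemma success_matrix_rows_proportional:
  assumes "i < i'" "enat i' < j"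
  shows "success_matrix p (enat i) j = (\<Prod>k=i+1..i'. 1 - p k) * success_matrix p (enat i') j"
proof (cases j)
  case (enat j')
  then have j': "i' < j'" using assms by simp
  then have "{i+1..<j'} = {i+1..i'} \<union> {i'+1..<j'}" using assms(1) by auto
  then have "(\<Prod>k=i+1..<j'. 1 - p k) = (\<Prod>k=i+1..i'. 1 - p k) * (\<Prod>k=i'+1..<j'. 1 - p k)"
    by (simp only:) (rule prod.union_disjoint, auto)
  then show ?thesis using enat j' assms(1) by simp
next
  case infinity
  have split: "(\<Prod>k=i+1..n. 1 - p k) = (\<Prod>k=i+1..i'. 1 - p k) * (\<Prod>k=i'+1..n. 1 - p k)"
    if "i' \<le> n" for n
  proof -
    have "{i+1..n} = {i+1..i'} \<union> {i'+1..n}" using assms(1) that by auto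
    then show ?thesis by (simp only:) (rule prod.union_disjoint, auto)
  qed
  have "(\<lambda>n. (\<Prod>k=i+1..i'. 1 - p k) * (\<Prod>k=i'+1..n. 1 - p k))
      \<longlonglongrightarrow> (\<Prod>k=i+1..i'. 1 - p k) * success_matrix p (enat i') \<infinity>"
    by (intro tendsto_intros failure_prod_tendsto)
  then have "(\<lambda>n. \<Prod>k=i+1..n. 1 - p k) \<longlonglongrightarrow> (\<Prod>k=i+1..i'. 1 - p k) * success_matrix p (enat i') \<infinity>"
    by (rule Lim_transform_eventually) (rule eventually_mono[OF eventually_ge_at_top split[symmetric]])
  then show ?thesis using failure_prod_tendsto[of i] infinity LIMSEQ_unique by blast
qed

lemma totally_positive_success_matrix: "totally_positive (success_matrix p)"
proof (rule totally_positive_if_rows_proportional)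
  show "0 \<le> success_matrix p i j" for i j
    by (rule success_matrix_nonneg)
  \<comment> \<open>Being below some \<open>j'\<close>, the column \<open>j\<close> is finite, which
    excludes the entry 1 at (\<infinity>, \<infinity>).\<close>
  show "success_matrix p i j = 0" if "j < j'" "j \<le> i" for i j j' :: enat
    using that by (cases i; cases j) auto
  show "\<exists>a. \<forall>j>i'. success_matrix p i j = a * success_matrix p i' j" if less: "i < i'" for i i' :: enat
  \<comment> \<open>For \<open>i' = \<infinity>\<close> no column lies beyond \<open>i'\<close> and
    the claim is vacuous.\<close>
  proof (cases i')
    case (enat m')
    then obtain m where "i = enat m" "m < m'" using less by (cases i) auto
    then show ?thesis using enat success_matrix_rows_proportional by blast
  qed simp
qed

end

section \<open>Paths of the success chain in terms of trials\<close>

text \<open>A finite infimum forces the set to be nonempty, and a nonempty subset of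
  \<open>enat\<close> attains its infimum because the order is a well-order.\<close>

lemma Inf_enat_eq_enat_iff:
  "Inf {enat j | j. Q j} = enat m \<longleftrightarrow> Q m \<and> (\<forall>k<m. \<not> Q k)"
proof
  assume inf: "Inf {enat j | j. Q j} = enat m"
  then have "{enat j | j. Q j} \<noteq> {}"
    by (auto simp: Inf_enat_def split: if_splits)
  then have "Inf {enat j | j. Q j} \<in> {enat j | j. Q j}"
    by (metis (mono_tags, lifting) Inf_enat_def LeastI ex_in_conv)
  moreover have "\<not> Q k" if "k < m" for k
  proof
    assume "Q k"
    then have "Inf {enat j | j. Q j} \<le> enat k" by (auto intro: Inf_lower)
    then show False using inf that by simp
  qed
  ultimately show "Q m \<and> (\<forall>k<m. \<not> Q k)" using inf by auto
next
  assume "Q m \<and> (\<forall>k<m. \<not> Q k)"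
  then show "Inf {enat j | j. Q j} = enat m"
    by (intro antisym Inf_lower Inf_greatest) (auto intro: leI)
qed

lemma Inf_enat_eq_infinity_iff: "Inf {enat j | j. Q j} = \<infinity> \<longleftrightarrow> (\<forall>j. \<not> Q j)"
proof
  show "\<forall>j. \<not> Q j" if "Inf {enat j | j. Q j} = \<infinity>"
  proof (intro allI notI)
    fix j assume "Q j"
    then have "Inf {enat j | j. Q j} \<le> enat j" by (auto intro: Inf_lower)
    then show False using that by simp
  qed
qed (simp add: top_enat_def)

text \<open>Replaces the infimum in the recursion by conditions on single trials, the form needed
  for measurability and for cylinder events.\<close>

lemma success_chain_Suc_eq_enat_iff:
  "success_chain X (Suc n) \<omega> = enat j \<longleftrightarrow>
    success_chain X n \<omega> < enat j \<and> X j \<omega> \<and> (\<forall>k<j. success_chain X n \<omega> < enat k \<longrightarrow> \<not> X k \<omega>)"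
  by (auto simp: Inf_enat_eq_enat_iff)

lemma success_chain_Suc_eq_infinity_iff:
  "success_chain X (Suc n) \<omega> = \<infinity> \<longleftrightarrow> (\<forall>k. success_chain X n \<omega> < enat k \<longrightarrow> \<not> X k \<omega>)"
  by (auto simp: Inf_enat_eq_infinity_iff)

text \<open>Induction on the number of jumps: a last jump from \<open>h\<close> to \<open>i\<close>
  says that the trials strictly between fail and trial \<open>i\<close> succeeds. Comparing with a
  reference outcome \<open>\<omega>0\<close> avoids spelling out the pattern of trials.\<close>

lemma success_chain_path_eq_iff:
  assumes "success_chain X n \<omega>0 = enat i"
  shows "(\<forall>k\<le>n. success_chain X k \<omega> = success_chain X k \<omega>0) \<longleftrightarrow> (\<forall>k\<in>{1..i}. X k \<omega> = X k \<omega>0)"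
  using assms
proof (induction n arbitrary: i)
  case 0
  then show ?case by (simp add: zero_enat_def)
next
  case (Suc n)
  have step: "success_chain X n \<omega>0 < enat i" "X i \<omega>0"
    "\<And>k. k < i \<Longrightarrow> success_chain X n \<omega>0 < enat k \<Longrightarrow> \<not> X k \<omega>0"
    using Suc.prems unfolding success_chain_Suc_eq_enat_iff by auto
  then obtain h where h: "success_chain X n \<omega>0 = enat h" "h < i"
    by (cases "success_chain X n \<omega>0") auto
  note IH = Suc.IH[OF h(1)]
  show ?case
  proof
    assume path: "\<forall>k\<le>Suc n. success_chain X k \<omega> = success_chain X k \<omega>0"
    then have n: "success_chain X n \<omega> = enat h" and "success_chain X (Suc n) \<omega> = enat i"
      using h Suc.prems by (metis le_Suc_eq order_refl)+
    then have "X i \<omega>" and "\<And>k. k < i \<Longrightarrow> h < k \<Longrightarrow> \<not> X k \<omega>"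
      unfolding success_chain_Suc_eq_enat_iff by auto
    \<comment> \<open>The induction hypothesis settles the trials up to \<open>h\<close>; on the
      remaining ones both outcomes show failures and then a success at \<open>i\<close>.\<close>
    moreover have "\<forall>k\<in>{1..h}. X k \<omega> = X k \<omega>0"
      using path IH by auto
    ultimately show "\<forall>k\<in>{1..i}. X k \<omega> = X k \<omega>0"
      using step h by (metis atLeastAtMost_iff enat_ord_simps(2) linorder_not_le order_le_imp_less_or_eq)
  next
    assume trials: "\<forall>k\<in>{1..i}. X k \<omega> = X k \<omega>0"
    then have path: "\<forall>k\<le>n. success_chain X k \<omega> = success_chain X k \<omega>0"
      using IH h by auto
    then have n: "success_chain X n \<omega> = enat h"
      using h by auto
    have "success_chain X (Suc n) \<omega> = enat i"
      unfolding success_chain_Suc_eq_enat_iff n using trials step h by auto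
    then show "\<forall>k\<le>Suc n. success_chain X k \<omega> = success_chain X k \<omega>0"
      using path Suc.prems by (metis le_Suc_eq)
  qed
qed

section \<open>Independent trials: cylinder probabilities and the Markov property\<close>

context prob_space
begin

context
  fixes X :: "nat \<Rightarrow> 'a \<Rightarrow> bool" and p :: "nat \<Rightarrow> real"
  assumes indep: "indep_vars (\<lambda>_. count_space UNIV) X {1..}"
    and prob_X: "\<And>j. 1 \<le> j \<Longrightarrow> prob {\<omega> \<in> space M. X j \<omega>} = p j"
begin

lemma X_sets: "1 \<le> j \<Longrightarrow> {\<omega> \<in> space M. X j \<omega>} \<in> sets M"
proof -
  assume "1 \<le> j"
  then have "X j \<in> measurable M (count_space UNIV)"
    using indep by (simp add: indep_vars_def)
  then show ?thesis by (simp add: pred_def)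
qed

lemma p_bounds: "1 \<le> j \<Longrightarrow> 0 \<le> p j" "1 \<le> j \<Longrightarrow> p j \<le> 1"
  by (simp_all flip: prob_X)

lemma prob_cylinder:
  "prob {\<omega> \<in> space M. \<forall>k\<in>{1..n}. X k \<omega> = b k} = (\<Prod>k=1..n. if b k then p k else 1 - p k)"
\<comment> \<open>An intersection over the empty index set would be the whole type instead of
  \<open>space M\<close>, and the product rule for independent variables asks for a nonempty index
  set.\<close>
proof (cases "n = 0")
  case True
  then show ?thesis by (simp add: prob_space)
next
  case False
  have "prob (X k -` {b k} \<inter> space M) = (if b k then p k else 1 - p k)" if "k \<in> {1..n}" for k
  proof -
    have k: "1 \<le> k" using that by simp
    have "X k -` {b k} \<inter> space M = {\<omega> \<in> space M. X k \<omega> = b k}" by auto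
    moreover have "{\<omega> \<in> space M. \<not> X k \<omega>} = space M - {\<omega> \<in> space M. X k \<omega>}" by auto
    ultimately show ?thesis
      using prob_X[OF k] prob_compl[OF X_sets[OF k]] by (cases "b k") auto
  qed
  moreover have "{\<omega> \<in> space M. \<forall>k\<in>{1..n}. X k \<omega> = b k} = (\<Inter>k\<in>{1..n}. X k -` {b k} \<inter> space M)"
    using False by auto
  moreover have "prob (\<Inter>k\<in>{1..n}. X k -` {b k} \<inter> space M) = (\<Prod>k=1..n. prob (X k -` {b k} \<inter> space M))"
    using False by (intro indep_varsD[OF indep]) auto
  ultimately show ?thesis by simp
qed

lemma success_chain_measurable: "success_chain X n \<in> measurable M (count_space UNIV)"
proof (induction n)
  case (Suc n)
  have [measurable]: "Measurable.pred M (X k)" if "1 \<le> k" for k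
    using X_sets[OF that] by (simp add: pred_def)
  have pre: "{\<omega> \<in> space M. success_chain X n \<omega> < enat k} \<in> sets M" for k
    using measurable_sets[OF Suc, of "{..<enat k}"] by (simp add: vimage_def Int_def conj_commute)
  \<comment> \<open>Only the trials from 1 on are known to be measurable. For \<open>k = 0\<close>
    the first conjunct is already impossible, so the event is empty whatever \<open>X 0\<close>
    is.\<close>
  have S: "{\<omega> \<in> space M. success_chain X n \<omega> < enat k \<and> X k \<omega>} \<in> sets M" for k
  proof (cases "k = 0")
    case True
    then show ?thesis by (simp add: enat_0)
  next
    case False
    then show ?thesis using sets.Int[OF pre[of k] X_sets[of k]] by (simp add: Int_def conj_commute conj_left_commute)
  qed
  have [measurable]: "Measurable.pred M (\<lambda>\<omega>. success_chain X n \<omega> < enat k \<and> X k \<omega>)" for k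
    using S by (simp add: pred_def)
  have "success_chain X (Suc n) -` {v} \<inter> space M \<in> sets M" for v
  proof (cases v)
    case (enat j)
    have "success_chain X (Suc n) -` {v} \<inter> space M = {\<omega> \<in> space M. (success_chain X n \<omega> < enat j \<and> X j \<omega>) \<and>
        (\<forall>k\<in>{..<j}. \<not> (success_chain X n \<omega> < enat k \<and> X k \<omega>))}"
      unfolding enat by (auto simp: success_chain_Suc_eq_enat_iff simp del: success_chain.simps)
    also have "\<dots> \<in> sets M" by measurable
    finally show ?thesis .
  next
    case infinity
    have "success_chain X (Suc n) -` {v} \<inter> space M =
        {\<omega> \<in> space M. \<forall>k. \<not> (success_chain X n \<omega> < enat k \<and> X k \<omega>)}"
      unfolding infinity by (auto simp: success_chain_Suc_eq_infinity_iff simp del: success_chain.simps)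
    also have "\<dots> \<in> sets M" by measurable
    finally show ?thesis .
  qed
  then show ?case by (simp add: measurable_count_space_eq2_countable del: success_chain.simps)
qed simp

lemma prob_next_success:
  assumes "i < j"
  shows "prob {\<omega> \<in> space M. (\<forall>k\<in>{1..i}. X k \<omega> = b k) \<and> X j \<omega> \<and> (\<forall>k<j. i < k \<longrightarrow> \<not> X k \<omega>)} =
    prob {\<omega> \<in> space M. \<forall>k\<in>{1..i}. X k \<omega> = b k} * success_matrix p (enat i) (enat j)"
proof -
  \<comment> \<open>The pattern of the whole event on the trials 1 to \<open>j\<close>: prescribed
    up to \<open>i\<close>, then failures, then a success at \<open>j\<close>. The cylinder formula
    then splits at \<open>i\<close>.\<close>
  let ?c = "\<lambda>k. if k \<le> i then b k else k = j"
  have "{\<omega> \<in> space M. (\<forall>k\<in>{1..i}. X k \<omega> = b k) \<and> X j \<omega> \<and> (\<forall>k<j. i < k \<longrightarrow> \<not> X k \<omega>)} =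
      {\<omega> \<in> space M. \<forall>k\<in>{1..j}. X k \<omega> = ?c k}"
  proof (intro Collect_cong conj_cong refl iffI)
    fix \<omega> assume "(\<forall>k\<in>{1..i}. X k \<omega> = b k) \<and> X j \<omega> \<and> (\<forall>k<j. i < k \<longrightarrow> \<not> X k \<omega>)"
    then show "\<forall>k\<in>{1..j}. X k \<omega> = ?c k" by (metis atLeastAtMost_iff not_le order_le_less)
  next
    fix \<omega> assume c: "\<forall>k\<in>{1..j}. X k \<omega> = ?c k"
    have "X k \<omega> = b k" if "k \<in> {1..i}" for k using c assms that by simp
    moreover have "X j \<omega>" using c assms by simp
    moreover have "\<not> X k \<omega>" if "k < j" "i < k" for k using c that by simp
    ultimately show "(\<forall>k\<in>{1..i}. X k \<omega> = b k) \<and> X j \<omega> \<and> (\<forall>k<j. i < k \<longrightarrow> \<not> X k \<omega>)" by blast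
  qed
  moreover have "{1..j} = {1..i} \<union> insert j {i+1..<j}" using assms by auto
  then have "(\<Prod>k=1..j. if ?c k then p k else 1 - p k) =
      (\<Prod>k=1..i. if ?c k then p k else 1 - p k) * (\<Prod>k\<in>insert j {i+1..<j}. if ?c k then p k else 1 - p k)"
    using assms by (simp only:) (rule prod.union_disjoint, auto)
  moreover have "(\<Prod>k\<in>insert j {i+1..<j}. if ?c k then p k else 1 - p k) = success_matrix p (enat i) (enat j)"
    using assms by (auto intro!: prod.cong)
  ultimately show ?thesis by (simp only: prob_cylinder) simp
qed

text \<open>The event is the decreasing intersection of the cylinders \<open>?B n\<close>, which
  demand failures only up to trial \<open>i + n\<close>. Continuity from above turns their product
  formula into the limit entry of the matrix.\<close>

lemma prob_no_more_success:
  "prob {\<omega> \<in> space M. (\<forall>k\<in>{1..i}. X k \<omega> = b k) \<and> (\<forall>k>i. \<not> X k \<omega>)} =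
    prob {\<omega> \<in> space M. \<forall>k\<in>{1..i}. X k \<omega> = b k} * success_matrix p (enat i) \<infinity>"
proof -
  let ?c = "\<lambda>k. k \<le> i \<and> b k"
  let ?E = "{\<omega> \<in> space M. \<forall>k\<in>{1..i}. X k \<omega> = b k}"
  let ?B = "\<lambda>n. {\<omega> \<in> space M. \<forall>k\<in>{1..i+n}. X k \<omega> = ?c k}"
  have B: "prob (?B n) = prob ?E * (\<Prod>k=i+1..i+n. 1 - p k)" for n
  proof -
    have "{1..i+n} = {1..i} \<union> {i+1..i+n}" by auto
    then have "(\<Prod>k=1..i+n. if ?c k then p k else 1 - p k) =
        (\<Prod>k=1..i. if ?c k then p k else 1 - p k) * (\<Prod>k=i+1..i+n. if ?c k then p k else 1 - p k)"
      by (simp only:) (rule prod.union_disjoint, auto)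
    then show ?thesis by (simp only: prob_cylinder) simp
  qed
  have "range ?B \<subseteq> sets M"
  proof -
    have [measurable]: "Measurable.pred M (X k)" if "k \<in> {1..i+n}" for k n
      using X_sets[of k] that by (simp add: pred_def)
    have "?B n \<in> sets M" for n by measurable
    then show ?thesis by auto
  qed
  then have lim: "(\<lambda>n. prob (?B n)) \<longlonglongrightarrow> prob (\<Inter>n. ?B n)"
    by (rule finite_Lim_measure_decseq) (auto simp: decseq_def)
  have INT: "(\<Inter>n. ?B n) = {\<omega> \<in> space M. (\<forall>k\<in>{1..i}. X k \<omega> = b k) \<and> (\<forall>k>i. \<not> X k \<omega>)}"
  proof -
    have "(\<forall>n. \<forall>k\<in>{1..i+n}. X k \<omega> = ?c k) \<longleftrightarrow> (\<forall>k\<ge>1. X k \<omega> = ?c k)" for \<omega>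
      by (metis atLeastAtMost_iff le_add2)
    moreover have "(\<forall>k\<ge>1. X k \<omega> = ?c k) \<longleftrightarrow> (\<forall>k\<in>{1..i}. X k \<omega> = b k) \<and> (\<forall>k>i. \<not> X k \<omega>)" for \<omega>
    proof
      assume c: "\<forall>k\<ge>1. X k \<omega> = ?c k"
      have "X k \<omega> = b k" if "k \<in> {1..i}" for k using c that by simp
      moreover have "\<not> X k \<omega>" if "i < k" for k using c that by simp
      ultimately show "(\<forall>k\<in>{1..i}. X k \<omega> = b k) \<and> (\<forall>k>i. \<not> X k \<omega>)" by blast
    qed (auto intro: leI)
    moreover have "(\<Inter>n. ?B n) = {\<omega> \<in> space M. \<forall>n. \<forall>k\<in>{1..i+n}. X k \<omega> = ?c k}"
      by auto
    ultimately show ?thesis by simp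
  qed
  have "(\<lambda>n. prob ?E * (\<Prod>k=i+1..i+n. 1 - p k)) \<longlonglongrightarrow> prob ?E * success_matrix p (enat i) \<infinity>"
  proof -
    have "(\<lambda>n. \<Prod>k=i+1..n. 1 - p k) \<longlonglongrightarrow> success_matrix p (enat i) \<infinity>"
      by (rule failure_prod_tendsto) (simp_all add: p_bounds)
    from LIMSEQ_ignore_initial_segment[OF this, of i]
    have "(\<lambda>n. \<Prod>k=i+1..i+n. 1 - p k) \<longlonglongrightarrow> success_matrix p (enat i) \<infinity>"
      by (simp only: add.commute)
    then show ?thesis by (rule tendsto_mult_left)
  qed
  from LIMSEQ_unique[OF lim[unfolded B INT] this] show ?thesis .
qed

text \<open>A path ending in a finite state is a cylinder event, so the joint probability with the
  next jump factorizes by the two preceding lemmas; division by the probability of the path gives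
  the transition entry.\<close>

lemma markov_chain_success_chain: "markov_chain M (success_chain X) (success_matrix p)"
  unfolding markov_chain_def
proof (intro conjI allI impI)
  show "prob_space M" by (rule prob_space_axioms)
  show "success_chain X n \<in> measurable M (count_space UNIV)" for n
    by (rule success_chain_measurable)
  show "0 \<le> success_matrix p i j" for i j
    by (rule success_matrix_nonneg[OF p_bounds])
  show "(success_matrix p i has_sum 1) UNIV" for i
    by (rule success_matrix_has_sum[OF p_bounds])
next
  fix n s j
  let ?path = "\<lambda>\<omega>. \<forall>k\<le>n. success_chain X k \<omega> = s k"
  let ?E = "{\<omega> \<in> space M. ?path \<omega>}"
  let ?F = "{\<omega> \<in> space M. success_chain X (Suc n) \<omega> = j \<and> ?path \<omega>}"
  assume pos: "prob ?E > 0"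
  have "prob ?F = prob ?E * success_matrix p (s n) j"
  proof (cases "s n")
    case infinity
    \<comment> \<open>No trial index exceeds \<infinity>, so the chain is absorbed there.\<close>
    then have "success_chain X (Suc n) \<omega> = \<infinity>" if "?path \<omega>" for \<omega>
      using that unfolding success_chain_Suc_eq_infinity_iff by auto
    then have "success_chain X (Suc n) \<omega> = j \<and> ?path \<omega> \<longleftrightarrow> j = \<infinity> \<and> ?path \<omega>" for \<omega>
      by metis
    then have F: "?F = (if j = \<infinity> then ?E else {})"
      by (simp del: success_chain.simps)
    show ?thesis unfolding F using infinity by (cases j) auto
  next
    case (enat i)
    \<comment> \<open>Positive probability makes the path event nonempty; any outcome in it serves
      as the reference whose trials define the cylinder.\<close>
    obtain \<omega>0 where \<omega>0: "?path \<omega>0"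
      using pos by (metis (mono_tags, lifting) Collect_empty_eq less_irrefl measure_empty)
    then have "success_chain X n \<omega>0 = enat i" using enat by auto
    then have path_iff: "?path \<omega> \<longleftrightarrow> (\<forall>k\<in>{1..i}. X k \<omega> = X k \<omega>0)" for \<omega>
      using success_chain_path_eq_iff[of X n \<omega>0 i \<omega>] \<omega>0 by auto
    have at_i: "success_chain X n \<omega> = enat i" if "?path \<omega>" for \<omega>
      using that enat by auto
    show ?thesis
    proof (cases j)
      case j: (enat j')
      have F: "?F = (if i < j' then {\<omega> \<in> space M. ?path \<omega> \<and> X j' \<omega> \<and> (\<forall>k<j'. i < k \<longrightarrow> \<not> X k \<omega>)} else {})"
        unfolding j success_chain_Suc_eq_enat_iff using at_i by auto
      show ?thesis
      proof (cases "i < j'")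
        case True
        then show ?thesis
          unfolding F unfolding j enat path_iff by (simp only: prob_next_success if_True)
      next
        case False
        then show ?thesis unfolding F unfolding j enat by simp
      qed
    next
      case infinity
      have F: "?F = {\<omega> \<in> space M. ?path \<omega> \<and> (\<forall>k>i. \<not> X k \<omega>)}"
        unfolding infinity success_chain_Suc_eq_infinity_iff using at_i by auto
      show ?thesis
        unfolding F unfolding infinity enat path_iff by (rule prob_no_more_success)
    qed
  qed
  then show "cond_prob M (\<lambda>\<omega>. success_chain X (Suc n) \<omega> = j) ?path = success_matrix p (s n) j"
    using pos by (simp add: cond_prob_def del: success_chain.simps)
qed

end

end

theorem theorem3:
  fixes \<Omega> :: "'a measure" and X :: "nat \<Rightarrow> 'a \<Rightarrow> bool" and p :: "nat \<Rightarrow> real"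
  assumes "prob_space \<Omega>"
    and "prob_space.indep_vars \<Omega> (\<lambda>_. count_space UNIV) X {1..}"
    and "\<And>j. j \<ge> 1 \<Longrightarrow> measure \<Omega> {\<omega> \<in> space \<Omega>. X j \<omega>} = p j"
    and "\<And>j. j \<ge> 1 \<Longrightarrow> p j > 0"
  shows "markov_chain \<Omega> (success_chain X) (success_matrix p) \<and> totally_positive (success_matrix p)"
proof -
  interpret prob_space \<Omega> by fact
  have "0 \<le> p j" "p j \<le> 1" if "1 \<le> j" for j
    using p_bounds[OF assms(2)] assms(3) that by blast+
  then show ?thesis
    using markov_chain_success_chain[OF assms(2)] assms(3) totally_positive_success_matrix by blast
qed

end
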